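(* Let $A_c\in\mathbb{R}^{n\times n}$, $G\in\mathbb{R}^{m\times n}$, $b\in\mathbb{R}^m$, let $\mathcal{P}=\{x\in\mathbb{R}^n\mid Gx\le b\}$ and let $\gamma>0$. Then there exists $H\in\mathbb{R}^{m\times m}$ with $H+\gamma I\ge 0$, $HG=GA_c$ and $Hb\le 0$ if and only if $(I+\gamma^{-1}A_c)\mathcal{P}\subseteq\mathcal{P}$.
   Context: Matrix and vector inequalities are entrywise: $M\ge 0$ means all entries of $M$ are nonnegative. The matrix $I+\Delta t A_c$ is the coefficient matrix of the discrete system obtained from $\dot x(t)=A_cx(t)$ by the forward Euler method with steplength $\Delta t$.
   Formalization: The polyhedron P is assumed nonempty; without this the claim fails, e.g. for n=1, m=2, G=(1,0)^T, b=(0,-1)^T, γ=1, A_c=-2, where P is empty, so the inclusion is trivial, but HG=GA_c forces (H+γI)_{11}=-1<0. *)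

theory Defs
  imports "HOL-Analysis.Analysis"
begin

text \<open>The order on \<open>real ^ 'n\<close> is the library's componentwise order; applied to
  \<open>real ^ 'n ^ 'm\<close>, a vector of vectors, it is the entrywise order on matrices.\<close>

definition polyhedron_of :: "real ^ 'n ^ 'm \<Rightarrow> real ^ 'm \<Rightarrow> (real ^ 'n) set" where
  "polyhedron_of G b = {x. G *v x \<le> b}"

text \<open>Theorems characterising invariance of a polyhedron by a matrix \<open>H\<close> need it nonempty. For \<open>n = 1\<close>,
  \<open>m = 2\<close>, \<open>G = (1, 0)\<close> (a column), \<open>b = (0, -1)\<close> and \<open>A\<^sub>c = -2\<gamma>\<close> the polyhedron is empty, so
  it is trivially mapped into itself, but \<open>H G = G A\<^sub>c\<close> forces the upper left entry of
  \<open>H + \<gamma> I\<close> to be \<open>-\<gamma> < 0\<close>.\<close>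

end

theory Submission
  imports Defs
begin

text \<open>
  Put \<open>M = I + \<gamma>\<^sup>-\<^sup>1 A\<^sub>c\<close>. Invariance of \<open>P = {x. G x \<le> b}\<close> under \<open>M\<close> says
  that the system \<open>G x \<le> b\<close> implies the system \<open>G M x \<le> b\<close>. By the affine form of Farkas'
  lemma, an inequality implied by a consistent system is dominated by a nonnegative combination of
  the inequalities of that system; collecting the multipliers of all rows in a matrix \<open>K\<close>,
  invariance becomes the existence of \<open>K \<ge> 0\<close> with \<open>K G = G M\<close> and \<open>K b \<le> b\<close>
  (\<open>farkas_affine_matrix\<close>). The substitution \<open>H = \<gamma> (K - I)\<close> turns these three conditions
  into \<open>H + \<gamma> I \<ge> 0\<close>, \<open>H G = G A\<^sub>c\<close> and \<open>H b \<le> 0\<close>.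

  Farkas' lemma itself is a separation argument. The image of the nonnegative orthant under a linear
  map is a finitely generated convex cone, hence closed, so a point outside it is cut off by a
  hyperplane through the origin (\<open>farkas_linear\<close>). The affine form follows by homogenization: the
  cone generated by the vectors \<open>(G\<^sub>i, b\<^sub>i)\<close> and \<open>(0, 1)\<close> contains \<open>(c, d)\<close> whenever \<open>G x \<le> b\<close>
  is consistent and implies \<open>c \<bullet> x \<le> d\<close>.
\<close>

lemma convex_cone_hull_Basis:
  "convex_cone hull (Basis :: 'a::euclidean_space set) = {x. \<forall>i\<in>Basis. 0 \<le> x \<bullet> i}"
proof
  have "Basis \<subseteq> {x :: 'a. \<forall>i\<in>Basis. 0 \<le> x \<bullet> i}"
    by (auto simp: inner_Basis)
  moreover have "convex_cone {x :: 'a. \<forall>i\<in>Basis. 0 \<le> x \<bullet> i}"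
    by (auto simp: convex_cone_iff inner_add_left intro!: exI[of _ 0])
  ultimately show "convex_cone hull Basis \<subseteq> {x :: 'a. \<forall>i\<in>Basis. 0 \<le> x \<bullet> i}"
    by (rule hull_minimal)
next
  show "{x :: 'a. \<forall>i\<in>Basis. 0 \<le> x \<bullet> i} \<subseteq> convex_cone hull Basis"
  proof
    fix x :: 'a
    assume x: "x \<in> {x. \<forall>i\<in>Basis. 0 \<le> x \<bullet> i}"
    have "(\<Sum>i\<in>B. (x \<bullet> i) *\<^sub>R i) \<in> convex_cone hull Basis" if "finite B" "B \<subseteq> Basis" for B
      using that
    proof (induction B)
      case empty
      then show ?case by (simp add: convex_cone_hull_contains_0)
    next
      case (insert i B)
      then have "(x \<bullet> i) *\<^sub>R i \<in> convex_cone hull Basis"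
        using x by (intro convex_cone_hull_mul hull_inc) auto
      with insert show ?case by (auto intro: convex_cone_hull_add)
    qed
    from this[of Basis] show "x \<in> convex_cone hull Basis"
      by (simp add: euclidean_representation)
  qed
qed

lemma closed_linear_image_nonneg_orthant:
  fixes f :: "'a::euclidean_space \<Rightarrow> 'b::euclidean_space"
  assumes "linear f"
  shows "closed (f ` {x. \<forall>i\<in>Basis. 0 \<le> x \<bullet> i})"
proof -
  have "closed (convex_cone hull (f ` Basis))"
    by (simp add: closed_convex_cone_hull)
  then show ?thesis
    by (simp add: convex_cone_hull_linear_image[OF assms] convex_cone_hull_Basis)
qed

lemma farkas_linear:
  fixes f :: "'a::euclidean_space \<Rightarrow> 'b::euclidean_space"
  assumes f: "linear f"
    and sep: "\<And>u. (\<And>i. i \<in> Basis \<Longrightarrow> 0 \<le> u \<bullet> f i) \<Longrightarrow> 0 \<le> u \<bullet> z"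
  shows "\<exists>y. (\<forall>i\<in>Basis. 0 \<le> y \<bullet> i) \<and> f y = z"
proof (rule ccontr)
  define K where "K = f ` {x. \<forall>i\<in>Basis. 0 \<le> x \<bullet> i}"
  assume "\<not> ?thesis"
  then have "z \<notin> K" by (auto simp: K_def)
  have K: "K = convex_cone hull (f ` Basis)"
    by (simp add: K_def convex_cone_hull_linear_image[OF f] convex_cone_hull_Basis)
  have "closed K"
    unfolding K_def using f by (rule closed_linear_image_nonneg_orthant)
  moreover have "convex K"
    by (simp add: K convex_convex_cone_hull)
  ultimately obtain u r where u: "u \<bullet> z < r" "\<And>x. x \<in> K \<Longrightarrow> r < u \<bullet> x"
    using separating_hyperplane_closed_point[of K z] \<open>z \<notin> K\<close> by blast
  have "r < 0"
    using u(2)[of 0] by (simp add: K convex_cone_hull_contains_0)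
  have "0 \<le> u \<bullet> x" if "x \<in> K" for x
  proof (rule ccontr)
    assume neg: "\<not> 0 \<le> u \<bullet> x"
    \<comment> \<open>A multiple of \<open>x\<close> would lie on the separating hyperplane itself.\<close>
    have "(r / (u \<bullet> x)) *\<^sub>R x \<in> K"
      using that \<open>r < 0\<close> neg unfolding K
      by (intro convex_cone_hull_mul) (auto simp: divide_nonpos_neg)
    from u(2)[OF this] neg show False by simp
  qed
  then have "0 \<le> u \<bullet> f i" if "i \<in> Basis" for i
    using that by (simp add: K hull_inc)
  with sep u(1) \<open>r < 0\<close> show False by force
qed

text \<open>The system has to be consistent: an inconsistent one implies every inequality, but the
  cone spanned by the rows of \<open>G\<close> need not contain every \<open>c\<close>.\<close>

lemma farkas_affine:
  fixes G :: "real ^ 'n ^ 'm" and b :: "real ^ 'm" and c :: "real ^ 'n" and d :: real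
  assumes x0: "G *v x0 \<le> b"
    and imp: "\<And>x. G *v x \<le> b \<Longrightarrow> c \<bullet> x \<le> d"
  shows "\<exists>y\<ge>0. y v* G = c \<and> y \<bullet> b \<le> d"
proof -
  define f :: "(real ^ 'm) \<times> real \<Rightarrow> (real ^ 'n) \<times> real"
    where "f = (\<lambda>(y, s). (y v* G, y \<bullet> b + s))"
  have axis: "(axis i 1, 0) \<in> (Basis :: ((real ^ 'm) \<times> real) set)" for i
    by (simp add: Basis_prod_def axis_in_Basis_iff)
  have "linear f"
    by (rule linearI)
      (auto simp: f_def inner_add_left algebra_simps
        vector_matrix_left_distrib scaleR_vector_matrix_assoc)
  moreover have "0 \<le> u \<bullet> (c, d)" if nonneg: "\<And>i. i \<in> Basis \<Longrightarrow> 0 \<le> u \<bullet> f i" for u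
  proof -
    \<comment> \<open>With this sign, \<open>w / t\<close> is a point of the polyhedron if \<open>t > 0\<close>, and \<open>w\<close> is a
      recession direction if \<open>t = 0\<close>.\<close>
    obtain w t where u: "u = (- w, t)"
      by (metis minus_minus surj_pair)
    have t: "0 \<le> t"
      using nonneg[of "(0, 1)"] by (simp add: f_def u Basis_prod_def)
    have "(G *v w) $ i \<le> t * b $ i" for i
      using nonneg[OF axis]
      by (simp add: f_def u inner_axis' inner_commute[of w] dot_lmul_matrix)
    then have w: "G *v w \<le> t *\<^sub>R b"
      by (simp add: less_eq_vec_def)
    have "c \<bullet> w \<le> t * d"
    proof (cases "t = 0")
      case False
      with t have "0 < t" by simp
      have "G *v (inverse t *\<^sub>R w) \<le> b"
        using w \<open>0 < t\<close> by (simp add: less_eq_vec_def matrix_vector_mult_scaleR field_simps)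
      from imp[OF this] \<open>0 < t\<close> show ?thesis by (simp add: field_simps)
    next
      case True
      show ?thesis
      proof (rule ccontr)
        assume "\<not> c \<bullet> w \<le> t * d"
        with True have pos: "0 < c \<bullet> w" by simp
        \<comment> \<open>The ray from \<open>x0\<close> in direction \<open>w\<close> stays in the polyhedron; at parameter \<open>s\<close> the
          functional exceeds its bound.\<close>
        define s where "s = (d - c \<bullet> x0 + 1) / (c \<bullet> w)"
        have "0 \<le> s" using imp[OF x0] pos by (simp add: s_def)
        have "G *v (x0 + s *\<^sub>R w) \<le> b"
          unfolding less_eq_vec_def
        proof
          fix i
          have "s * (G *v w) $ i \<le> 0"
            using w True \<open>0 \<le> s\<close> by (simp add: less_eq_vec_def mult_nonneg_nonpos)
          moreover have "(G *v x0) $ i \<le> b $ i"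
            using x0 by (simp add: less_eq_vec_def)
          ultimately show "(G *v (x0 + s *\<^sub>R w)) $ i \<le> b $ i"
            by (simp add: matrix_vector_right_distrib matrix_vector_mult_scaleR)
        qed
        from imp[OF this] have "c \<bullet> x0 + s * (c \<bullet> w) \<le> d"
          by (simp add: inner_add_right)
        with pos show False by (simp add: s_def)
      qed
    qed
    then show ?thesis by (simp add: u inner_commute mult.commute)
  qed
  ultimately obtain y s where ys: "\<forall>i\<in>Basis. 0 \<le> (y, s) \<bullet> i" "f (y, s) = (c, d)"
    using farkas_linear[of f "(c, d)"] by auto
  have "0 \<le> y $ i" for i
    using bspec[OF ys(1) axis] by (simp add: inner_axis)
  moreover have "0 \<le> s"
    using bspec[OF ys(1), of "(0, 1)"] by (simp add: Basis_prod_def)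
  ultimately show ?thesis
    using ys(2) by (intro exI[of _ y]) (auto simp: f_def less_eq_vec_def)
qed

lemma matrix_vector_mult_mono:
  fixes K :: "real ^ 'm ^ 'k"
  assumes "K \<ge> 0" and "x \<le> y"
  shows "K *v x \<le> K *v y"
  using assms by (auto simp: less_eq_vec_def matrix_vector_mult_def intro!: sum_mono mult_left_mono)

lemma farkas_affine_matrix:
  fixes G :: "real ^ 'n ^ 'm" and b :: "real ^ 'm" and C :: "real ^ 'n ^ 'k" and d :: "real ^ 'k"
  assumes "polyhedron_of G b \<noteq> {}"
  shows "polyhedron_of G b \<subseteq> polyhedron_of C d \<longleftrightarrow> (\<exists>K\<ge>0. K ** G = C \<and> K *v b \<le> d)"
proof
  assume sub: "polyhedron_of G b \<subseteq> polyhedron_of C d"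
  from assms obtain x0 where x0: "G *v x0 \<le> b" by (auto simp: polyhedron_of_def)
  have "\<exists>y\<ge>0. y v* G = C $ i \<and> y \<bullet> b \<le> d $ i" for i
  proof (rule farkas_affine[OF x0])
    fix x assume "G *v x \<le> b"
    with sub have "C *v x \<le> d" by (auto simp: polyhedron_of_def)
    then show "C $ i \<bullet> x \<le> d $ i"
      by (simp add: less_eq_vec_def matrix_vector_mul_component)
  qed
  then obtain Y where Y: "\<And>i. Y i \<ge> 0" "\<And>i. Y i v* G = C $ i" "\<And>i. Y i \<bullet> b \<le> d $ i"
    by metis
  define K where "K = (\<chi> i. Y i)"
  have "K \<ge> 0" and "K *v b \<le> d"
    using Y(1,3) by (simp_all add: K_def less_eq_vec_def matrix_vector_mul_component)
  moreover have "K ** G = C"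
  proof -
    have "(K ** G) $ i $ j = (Y i v* G) $ j" for i j
      by (simp add: K_def matrix_matrix_mult_def vector_matrix_mult_def mult.commute)
    then show ?thesis by (simp add: vec_eq_iff Y(2))
  qed
  ultimately show "\<exists>K\<ge>0. K ** G = C \<and> K *v b \<le> d" by blast
next
  assume "\<exists>K\<ge>0. K ** G = C \<and> K *v b \<le> d"
  then obtain K where K: "K \<ge> 0" "K ** G = C" "K *v b \<le> d" by blast
  show "polyhedron_of G b \<subseteq> polyhedron_of C d"
  proof
    fix x assume "x \<in> polyhedron_of G b"
    then have "K *v (G *v x) \<le> K *v b"
      using K(1) by (intro matrix_vector_mult_mono) (simp_all add: polyhedron_of_def)
    with K(2,3) show "x \<in> polyhedron_of C d"
      by (auto simp: polyhedron_of_def matrix_vector_mul_assoc)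
  qed
qed

theorem lemma3p14:
  fixes A\<^sub>c :: "real ^ 'n ^ 'n" and G :: "real ^ 'n ^ 'm" and b :: "real ^ 'm" and \<gamma> :: real
  assumes "polyhedron_of G b \<noteq> {}" and "\<gamma> > 0"
  shows "(\<exists>H :: real ^ 'm ^ 'm. H + \<gamma> *\<^sub>R mat 1 \<ge> 0 \<and> H ** G = G ** A\<^sub>c \<and> H *v b \<le> 0) \<longleftrightarrow>
         (\<lambda>x. (mat 1 + inverse \<gamma> *\<^sub>R A\<^sub>c) *v x) ` polyhedron_of G b \<subseteq> polyhedron_of G b"
proof -
  define M where "M = mat 1 + inverse \<gamma> *\<^sub>R A\<^sub>c"
  have shift: "H + \<gamma> *\<^sub>R mat 1 \<ge> 0 \<and> H ** G = G ** A\<^sub>c \<and> H *v b \<le> 0 \<longleftrightarrow>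
      K \<ge> 0 \<and> K ** G = G ** M \<and> K *v b \<le> b"
    if H: "H = \<gamma> *\<^sub>R (K - mat 1)" for H K :: "real ^ 'm ^ 'm"
  proof -
    have "H + \<gamma> *\<^sub>R mat 1 = \<gamma> *\<^sub>R K"
      by (simp add: H scaleR_diff_right)
    then have 1: "H + \<gamma> *\<^sub>R mat 1 \<ge> 0 \<longleftrightarrow> K \<ge> 0"
      using \<open>\<gamma> > 0\<close> by (simp add: less_eq_vec_def zero_le_mult_iff)
    have "(K - mat 1) ** G = K ** G - mat 1 ** G"
      by (simp add: matrix_matrix_mult_def vec_eq_iff left_diff_distrib sum_subtractf
          del: matrix_mul_lid)
    then have HG: "H ** G = \<gamma> *\<^sub>R (K ** G - G)"
      by (simp add: H scalar_matrix_assoc[symmetric])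
    have "G ** A\<^sub>c = \<gamma> *\<^sub>R (G ** M - G)"
      using \<open>\<gamma> > 0\<close> by (simp add: M_def matrix_add_ldistrib matrix_scalar_ac scalar_matrix_assoc[symmetric])
    with HG have 2: "H ** G = G ** A\<^sub>c \<longleftrightarrow> K ** G = G ** M"
      using \<open>\<gamma> > 0\<close> by simp
    have "H *v b = \<gamma> *\<^sub>R (K *v b - b)"
      by (simp add: H scaleR_matrix_vector_assoc[symmetric] matrix_vector_mult_diff_rdistrib)
    then have 3: "H *v b \<le> 0 \<longleftrightarrow> K *v b \<le> b"
      using \<open>\<gamma> > 0\<close> by (simp add: less_eq_vec_def mult_le_0_iff)
    from 1 2 3 show ?thesis by blast
  qed
  have "(\<exists>H :: real ^ 'm ^ 'm. H + \<gamma> *\<^sub>R mat 1 \<ge> 0 \<and> H ** G = G ** A\<^sub>c \<and> H *v b \<le> 0) \<longleftrightarrow>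
      (\<exists>K\<ge>0. K ** G = G ** M \<and> K *v b \<le> b)" (is "?L \<longleftrightarrow> ?R")
  proof
    assume ?L
    then obtain H :: "real ^ 'm ^ 'm"
      where H: "H + \<gamma> *\<^sub>R mat 1 \<ge> 0 \<and> H ** G = G ** A\<^sub>c \<and> H *v b \<le> 0" by blast
    have "H = \<gamma> *\<^sub>R ((inverse \<gamma> *\<^sub>R H + mat 1) - mat 1)"
      using \<open>\<gamma> > 0\<close> by simp
    from shift[OF this] H show ?R by blast
  next
    assume ?R
    with shift[OF refl] show ?L by blast
  qed
  also have "\<dots> \<longleftrightarrow> polyhedron_of G b \<subseteq> polyhedron_of (G ** M) b"
    using farkas_affine_matrix[OF assms(1)] by blast
  also have "\<dots> \<longleftrightarrow> (\<lambda>x. M *v x) ` polyhedron_of G b \<subseteq> polyhedron_of G b"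
    by (auto simp: polyhedron_of_def matrix_vector_mul_assoc)
  finally show ?thesis by (simp add: M_def)
qed

end
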